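(* Let $n\ge1$ and let $\sigma$ be a permutation of $\{1,\dots,n\}$. For any integer $m\ge2$ and any $w\in\mathcal{W}^{(m)}_+$, the normal-play outcome in Partizan-Serial-Nim satisfies $$o(w)=\begin{cases}\phi_{\mathcal{P}\to\mathcal{N}}(o(w_\ast)) & \text{if } w\in\mathcal{W}^{(m)}_{=},\\ \phi_{\mathcal{N}\to\mathcal{P}}(o(w_{LR})) & \text{if } w\in\mathcal{W}^{(m)}_{\neq},\ w_L\in\mathcal{W}^{(m)}_{=},\ w_R\in\mathcal{W}^{(m)}_{=},\\ \phi_{\mathcal{N}\to\mathcal{L}}(o(w_{LR})) & \text{if } w\in\mathcal{W}^{(m)}_{\neq},\ w_L\in\mathcal{W}^{(m)}_{\neq},\ w_R\in\mathcal{W}^{(m)}_{=},\\ \phi_{\mathcal{N}\to\mathcal{R}}(o(w_{LR})) & \text{if } w\in\mathcal{W}^{(m)}_{\neq},\ w_L\in\mathcal{W}^{(m)}_{=},\ w_R\in\mathcal{W}^{(m)}_{\neq},\\ o(w_{LR}) & \text{if } w\in\mathcal{W}^{(m)}_{\neq},\ w_L\in\mathcal{W}^{(m)}_{\neq},\ w_R\in\mathcal{W}^{(m)}_{\neq}.\end{cases}$$ Here, for $X,Y\in\{\mathcal{L},\mathcal{R},\mathcal{N},\mathcal{P}\}$, $\phi_{X\to Y}$ is the self-map of $\{\mathcal{L},\mathcal{R},\mathcal{N},\mathcal{P}\}$ that sends $X$ to $Y$ and fixes the other three elements.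
   Context: Partizan-Serial-Nim: fix an integer $n\ge1$ and a permutation $\sigma$ of $[n]=\{1,\dots,n\}$. Positions are the elements of $\mathcal{W}=\{(w_1,\dots,w_n): w_i\in\mathbb{Z}_{\ge0}\}$; $\mathbf{0}=(0,\dots,0)$ is the only terminal position and $\mathcal{W}_+=\mathcal{W}\setminus\{\mathbf{0}\}$. For $w\in\mathcal{W}_+$, Left's target pile is $l(w)=\min\{i: w_i>0\}$ and Right's target pile $r(w)$ is the index $i$ with $w_i>0$ minimizing $\sigma(i)$. A Left (resp. Right) move from $w$ replaces the entry $w_{l(w)}$ (resp. $w_{r(w)}$) by any strictly smaller non-negative integer. Players alternate and the player who cannot move loses (normal play). Outcomes: $o(w)=\mathcal{L}$ (resp. $\mathcal{R}$) if Left (resp. Right) wins under optimal play no matter who plays first; $o(w)=\mathcal{N}$ if the player moving first wins; $o(w)=\mathcal{P}$ if the player moving second wins. $\mathcal{W}_{=}=\{w\in\mathcal{W}_+: l(w)=r(w)\}$ and $\mathcal{W}_{\neq}=\{w\in\mathcal{W}_+: l(w)\ne r(w)\}$. For $w\in\mathcal{W}_+$, $w_L$ (resp. $w_R$) is obtained from $w$ by replacing the $l(w)$-th (resp. $r(w)$-th) entry by $0$; if $w\in\mathcal{W}_{=}$ these coincide and are denoted $w_\ast$. Also $w_{LR}=(w_L)_R$. Uniform case: for $m\in\mathbb{Z}_{\ge1}$, $\mathcal{W}^{(m)}=\{w\in\mathcal{W}: w_i\in\{0,m\}\ \forall i\in[n]\}$, $\mathcal{W}^{(m)}_+=\mathcal{W}^{(m)}\cap\mathcal{W}_+$,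 $\mathcal{W}^{(m)}_{=}=\mathcal{W}^{(m)}\cap\mathcal{W}_{=}$, $\mathcal{W}^{(m)}_{\neq}=\mathcal{W}^{(m)}\cap\mathcal{W}_{\neq}$. *)

theory Defs
  imports "HOL-Combinatorics.Permutations"
begin

text \<open>A position \<open>(w\<^sub>1, \<dots>, w\<^sub>n)\<close> is encoded as a function on the natural numbers that vanishes
  outside \<open>{1..n}\<close>; in this way equality of functions is equality of tuples, and the target
  piles and the moves need not mention \<open>n\<close>.\<close>

type_synonym position = "nat \<Rightarrow> nat"

definition terminal :: position where
  "terminal = (\<lambda>_. 0)"

definition positions :: "nat \<Rightarrow> position set" where
  "positions n = {w. \<forall>i. i \<notin> {1..n} \<longrightarrow> w i = 0}"

definition positions_plus :: "nat \<Rightarrow> position set" where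
  "positions_plus n = positions n - {terminal}"

datatype player = Left | Right

fun opponent :: "player \<Rightarrow> player" where
  "opponent Left = Right"
| "opponent Right = Left"

text \<open>For Right the minimiser is unique on nonterminal positions because \<open>\<sigma>\<close> is injective.
  On \<^const>\<open>terminal\<close> the targets have no meaning.\<close>

fun target :: "(nat \<Rightarrow> nat) \<Rightarrow> player \<Rightarrow> position \<Rightarrow> nat" where
  "target \<sigma> Left w = (LEAST i. w i > 0)"
| "target \<sigma> Right w = (ARG_MIN \<sigma> i. w i > 0)"

definition move :: "(nat \<Rightarrow> nat) \<Rightarrow> player \<Rightarrow> position \<Rightarrow> position \<Rightarrow> bool" where
  "move \<sigma> p w w' \<longleftrightarrow>
     w \<noteq> terminal \<and> (\<exists>k < w (target \<sigma> p w). w' = w(target \<sigma> p w := k))"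

text \<open>\<open>wins_first \<sigma> p w\<close> and \<open>wins_second \<sigma> p w\<close>: player \<open>p\<close> can force a win from \<open>w\<close> when \<open>p\<close>,
  respectively the opponent of \<open>p\<close>, is the next to move. A player who cannot move loses: without
  moves \<open>first\<close> is not applicable and the premise of \<open>second\<close> holds vacuously.\<close>

inductive wins_first :: "(nat \<Rightarrow> nat) \<Rightarrow> player \<Rightarrow> position \<Rightarrow> bool"
  and wins_second :: "(nat \<Rightarrow> nat) \<Rightarrow> player \<Rightarrow> position \<Rightarrow> bool"
  for \<sigma> :: "nat \<Rightarrow> nat" and p :: player where
  first: "move \<sigma> p w w' \<Longrightarrow> wins_second \<sigma> p w' \<Longrightarrow> wins_first \<sigma> p w"
| second: "(\<And>w'. move \<sigma> (opponent p) w w' \<Longrightarrow> wins_first \<sigma> p w') \<Longrightarrow> wins_second \<sigma> p w"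

datatype outcome = \<L> | \<R> | \<N> | \<P>

text \<open>The final case is the one where the player moving second wins; see
  \<open>outcome_iff\<close> below.\<close>

definition outcome :: "(nat \<Rightarrow> nat) \<Rightarrow> position \<Rightarrow> outcome" where
  "outcome \<sigma> w =
    (if wins_first \<sigma> Left w \<and> wins_second \<sigma> Left w then \<L>
     else if wins_first \<sigma> Right w \<and> wins_second \<sigma> Right w then \<R>
     else if wins_first \<sigma> Left w \<and> wins_first \<sigma> Right w then \<N>
     else \<P>)"

definition positions_eq :: "nat \<Rightarrow> (nat \<Rightarrow> nat) \<Rightarrow> position set" where
  "positions_eq n \<sigma> = {w \<in> positions_plus n. target \<sigma> Left w = target \<sigma> Right w}"

definition positions_neq :: "nat \<Rightarrow> (nat \<Rightarrow> nat) \<Rightarrow> position set" where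
  "positions_neq n \<sigma> = {w \<in> positions_plus n. target \<sigma> Left w \<noteq> target \<sigma> Right w}"

text \<open>\<open>clear \<sigma> Left w\<close> and \<open>clear \<sigma> Right w\<close> are \<open>w\<^sub>L\<close> and \<open>w\<^sub>R\<close>.\<close>

definition clear :: "(nat \<Rightarrow> nat) \<Rightarrow> player \<Rightarrow> position \<Rightarrow> position" where
  "clear \<sigma> p w = w(target \<sigma> p w := 0)"

text \<open>The common value of \<open>w\<^sub>L\<close> and \<open>w\<^sub>R\<close>, only meaningful on \<^const>\<open>positions_eq\<close>.\<close>

definition clear_common :: "(nat \<Rightarrow> nat) \<Rightarrow> position \<Rightarrow> position" where
  "clear_common \<sigma> w = clear \<sigma> Left w"

definition uniform :: "nat \<Rightarrow> nat \<Rightarrow> position set" where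
  "uniform n m = {w \<in> positions n. \<forall>i \<in> {1..n}. w i \<in> {0, m}}"

definition uniform_plus :: "nat \<Rightarrow> nat \<Rightarrow> position set" where
  "uniform_plus n m = uniform n m \<inter> positions_plus n"

definition uniform_eq :: "nat \<Rightarrow> (nat \<Rightarrow> nat) \<Rightarrow> nat \<Rightarrow> position set" where
  "uniform_eq n \<sigma> m = uniform n m \<inter> positions_eq n \<sigma>"

definition uniform_neq :: "nat \<Rightarrow> (nat \<Rightarrow> nat) \<Rightarrow> nat \<Rightarrow> position set" where
  "uniform_neq n \<sigma> m = uniform n m \<inter> positions_neq n \<sigma>"

definition replace_outcome :: "outcome \<Rightarrow> outcome \<Rightarrow> outcome \<Rightarrow> outcome" where
  "replace_outcome X Y = id(X := Y)"

lemma clear_common_eq: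
  "w \<in> positions_eq n \<sigma> \<Longrightarrow> clear_common \<sigma> w = clear \<sigma> p w"
  by (cases p) (simp_all add: positions_eq_def clear_common_def clear_def)

lemma target_pos:
  assumes "w \<noteq> terminal"
  shows "w (target \<sigma> p w) > 0"
proof -
  obtain i where i: "w i > 0"
    using assms by (auto simp: terminal_def fun_eq_iff)
  show ?thesis
  proof (cases p)
    case Left
    then show ?thesis using LeastI[of "\<lambda>i. w i > 0", OF i] by simp
  next
    case Right
    then show ?thesis using arg_min_natI[of "\<lambda>i. w i > 0" i \<sigma>, OF i] by simp
  qed
qed

lemma move_positions:
  assumes "w \<in> positions n" "move \<sigma> p w w'"
  shows "w' \<in> positions n" "(\<Sum>i\<in>{1..n}. w' i) < (\<Sum>i\<in>{1..n}. w i)"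
proof -
  let ?t = "target \<sigma> p w"
  obtain k where k: "k < w ?t" "w' = w(?t := k)" and "w \<noteq> terminal"
    using assms(2) by (auto simp: move_def)
  then have t: "?t \<in> {1..n}"
    using assms(1) target_pos[of w \<sigma> p] by (force simp: positions_def)
  then show "w' \<in> positions n"
    using assms(1) k by (auto simp: positions_def)
  show "(\<Sum>i\<in>{1..n}. w' i) < (\<Sum>i\<in>{1..n}. w i)"
    by (rule sum_strict_mono_ex1) (use k t in auto)
qed

lemma wins_first_iff:
  "wins_first \<sigma> p w \<longleftrightarrow> (\<exists>w'. move \<sigma> p w w' \<and> wins_second \<sigma> p w')"
  by (auto elim: wins_first.cases intro: first)

lemma wins_second_iff:
  "wins_second \<sigma> p w \<longleftrightarrow> (\<forall>w'. move \<sigma> (opponent p) w w' \<longrightarrow> wins_first \<sigma> p w')"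
  by (auto elim: wins_second.cases intro: second)

lemma opponent_opponent [simp]: "opponent (opponent p) = p"
  by (cases p) auto

text \<open>Determinacy.\<close>

lemma wins_second_iff_not_wins_first:
  assumes "w \<in> positions n"
  shows "wins_second \<sigma> p w \<longleftrightarrow> \<not> wins_first \<sigma> (opponent p) w"
  using assms
proof (induction "\<Sum>i\<in>{1..n}. w i" arbitrary: w p rule: less_induct)
  case less
  have "wins_first \<sigma> p w' \<longleftrightarrow> \<not> wins_second \<sigma> (opponent p) w'"
    if "move \<sigma> (opponent p) w w'" for w'
    using less.hyps[of w' "opponent p"] move_positions[OF less.prems that] by simp
  then show ?case
    unfolding wins_second_iff[of \<sigma> p w] wins_first_iff[of \<sigma> "opponent p" w] by blast
qed

lemma outcome_iff:
  assumes "w \<in> positions n"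
  shows "outcome \<sigma> w = \<L> \<longleftrightarrow> wins_first \<sigma> Left w \<and> wins_second \<sigma> Left w"
    and "outcome \<sigma> w = \<R> \<longleftrightarrow> wins_first \<sigma> Right w \<and> wins_second \<sigma> Right w"
    and "outcome \<sigma> w = \<N> \<longleftrightarrow> wins_first \<sigma> Left w \<and> wins_first \<sigma> Right w"
    and "outcome \<sigma> w = \<P> \<longleftrightarrow> wins_second \<sigma> Left w \<and> wins_second \<sigma> Right w"
  using wins_second_iff_not_wins_first[OF assms, of \<sigma> Left]
    wins_second_iff_not_wins_first[OF assms, of \<sigma> Right]
  by (auto simp: outcome_def)

end

theory Submission
  imports Defs
begin

text \<open>
Everything rests on comparing a position \<open>w\<close> with the position \<open>u\<close> that remains once both current
target piles are gone. No player can reach another pile before clearing a target, so what matters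
is who has to move when \<open>u\<close> is reached.

If the players share their target, whoever moves first may clear it and so hand \<open>u\<close> to the opponent,
or, as the pile has at least two tokens, reduce it to a single token that the opponent must take.
The first player hence chooses who starts \<open>u\<close>, and loses only if the opponent wins \<open>u\<close> regardless of
who starts it (\<open>common_pile_wins_first\<close>, \<open>common_pile_wins_second\<close>).

If the targets differ, both piles have the same height. A player who wins \<open>u\<close> moving second
wins \<open>w\<close> moving second, by copying every move on the other pile (\<open>mirror\<close>), and a player who wins
\<open>u\<close> in both roles wins \<open>w\<close> in both roles (\<open>step_down\<close>). This determines the outcome of \<open>w\<close> unless
\<open>u\<close> has outcome \<open>\<N>\<close>. In that case both players want to start \<open>u\<close>, that is, to have the opponent
clear last, and all depends on whether clearing one's own target makes the opponent's pile a
common one: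

\<^item> If it does, a player who moves first is confined to the two piles and loses: the opponent
  copies moves but keeps a token in reserve near the end (\<open>keep_spare_token\<close>).

\<^item> If it does not, the first player wins by clearing (\<open>free_clearing_wins_first\<close>). The opponent's
  remaining pile then stands in front of \<open>u\<close>, while the player already moves on the first pile of
  \<open>u\<close>. The two strategies above, applied now to these two piles, win provided that the position
  behind them is favourable enough. This condition, \<open>advance\<close>, holds for every uniform position of
  outcome \<open>\<N>\<close>: it is passed on from \<open>u\<close> without its target piles to \<open>u\<close> itself
  (\<open>advance_if_outcome_N\<close>).

For \<open>u\<close> of outcome \<open>\<N>\<close>, each player thus wins \<open>w\<close> moving first exactly if clearing leads to a
position with distinct targets, which gives the four cases of the theorem with distinct targets.
\<close>

section \<open>Targets\<close>

text \<open>A minimiser over the nonempty piles stays the minimiser when other piles are removed. Injectivity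
is what makes Right's minimiser unique.\<close>

lemma target_stable:
  assumes "inj \<sigma>" "w' (target \<sigma> p w) > 0" "\<And>j. w' j > 0 \<Longrightarrow> w j > 0"
  shows "target \<sigma> p w' = target \<sigma> p w"
proof (cases p)
  case Left
  have "(LEAST i. w' i > 0) = (LEAST i. w i > 0)"
    by (rule Least_equality) (use assms Left in \<open>auto intro: Least_le\<close>)
  then show ?thesis using Left by simp
next
  case Right
  let ?r = "ARG_MIN \<sigma> i. w i > 0"
  have r: "w' ?r > 0" using assms(2) Right by simp
  let ?r' = "ARG_MIN \<sigma> i. w' i > 0"
  have r': "w' ?r' > 0" using arg_min_natI[of "\<lambda>i. w' i > 0", OF r] .
  have "\<sigma> ?r \<le> \<sigma> ?r'" by (rule arg_min_nat_le[of "\<lambda>i. w i > 0", OF assms(3)[OF r']])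
  moreover have "\<sigma> ?r' \<le> \<sigma> ?r" by (rule arg_min_nat_le[of "\<lambda>i. w' i > 0", OF r])
  ultimately have "?r' = ?r" using assms(1) by (simp add: inj_eq)
  then show ?thesis using Right by simp
qed

text \<open>From here on the targets of both players are used only through \<open>target_stable\<close> and
\<open>target_pos\<close>, so that every argument is valid for either player.\<close>

declare target.simps [simp del]

lemma wins_first_by_reducing:
  assumes "w a > 0" "target \<sigma> p w = a" "k < w a" "wins_second \<sigma> p (w(a := k))"
  shows "wins_first \<sigma> p w"
proof -
  have "w \<noteq> terminal" using assms(1) by (auto simp: terminal_def)
  then show ?thesis using assms unfolding wins_first_iff move_def by blast
qed

lemma wins_second_by_answering:
  assumes "target \<sigma> (opponent p) w = b" "\<And>k. k < w b \<Longrightarrow> wins_first \<sigma> p (w(b := k))"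
  shows "wins_second \<sigma> p w"
  using assms unfolding wins_second_iff move_def by blast

lemma move_clear:
  assumes "w \<noteq> terminal" "target \<sigma> p w = a"
  shows "move \<sigma> p w (w(a := 0))"
  using assms target_pos[OF assms(1), of \<sigma> p] unfolding move_def by blast

lemma wins_first_not_terminal: "wins_first \<sigma> p w \<Longrightarrow> w \<noteq> terminal"
  by (auto simp: wins_first_iff move_def)

section \<open>A common target pile\<close>

lemma common_targets:
  assumes "inj \<sigma>" "w \<noteq> terminal" "target \<sigma> p w = c" "target \<sigma> (opponent p) w = c" "k > 0"
  shows "target \<sigma> q (w(c := k)) = c"
proof -
  have "target \<sigma> q w = c" using assms(3,4) by (cases p; cases q) auto
  moreover have "w c > 0" using target_pos assms(2,3) by auto
  ultimately show ?thesis
    using target_stable[OF assms(1), of "w(c := k)" q w] assms(5) by (auto split: if_splits)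
qed

text \<open>If the opponent clears the pile, \<open>p\<close> starts what remains; if not, \<open>p\<close> clears it and the opponent
starts.\<close>

lemma common_pile_wins_second:
  assumes targets: "\<And>k q. k > 0 \<Longrightarrow> target \<sigma> q (t(c := k)) = c"
    and "wins_first \<sigma> p (t(c := 0))" "wins_second \<sigma> p (t(c := 0))" "x > 0"
  shows "wins_second \<sigma> p (t(c := x))"
proof (rule wins_second_by_answering)
  show "target \<sigma> (opponent p) (t(c := x)) = c" using targets \<open>x > 0\<close> .
  fix k
  show "wins_first \<sigma> p (t(c := x, c := k))"
  proof (cases "k = 0")
    case False
    then show ?thesis
      using assms wins_first_by_reducing[of "t(c := k)" c \<sigma> p 0] by simp
  qed (use assms in simp)
qed

text \<open>The first player decides who starts the remaining position: clearing the pile lets the opponent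
start it, and leaving a single token forces the opponent to clear.\<close>

lemma common_pile_wins_first:
  assumes targets: "\<And>k q. k > 0 \<Longrightarrow> target \<sigma> q (t(c := k)) = c"
    and "wins_first \<sigma> p (t(c := 0)) \<or> wins_second \<sigma> p (t(c := 0))" "x \<ge> 2"
  shows "wins_first \<sigma> p (t(c := x))"
proof (cases "wins_second \<sigma> p (t(c := 0))")
  case True
  then show ?thesis
    using targets \<open>x \<ge> 2\<close> wins_first_by_reducing[of "t(c := x)" c \<sigma> p 0] by simp
next
  case False
  have "wins_second \<sigma> p (t(c := 1))"
    by (rule wins_second_by_answering[of _ _ _ c]) (use False assms in auto)
  then show ?thesis
    using targets \<open>x \<ge> 2\<close> wins_first_by_reducing[of "t(c := x)" c \<sigma> p 1] by simp
qed

section \<open>Distinct target piles\<close>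

text \<open>The position \<open>u(a := x, b := y)\<close> consists of a pile of \<open>x\<close> tokens for \<open>p\<close>, a pile of \<open>y\<close> tokens for
the opponent, and a rest \<open>u\<close>. Each player is bound to the own pile while it is nonempty, even if the
other pile has already been cleared.\<close>

definition contest :: "(nat \<Rightarrow> nat) \<Rightarrow> player \<Rightarrow> nat \<Rightarrow> nat \<Rightarrow> position \<Rightarrow> bool" where
  "contest \<sigma> p a b u \<longleftrightarrow> a \<noteq> b \<and> u a = 0 \<and> u b = 0 \<and>
     (\<forall>x y. x > 0 \<longrightarrow> target \<sigma> p (u(a := x, b := y)) = a) \<and>
     (\<forall>x y. y > 0 \<longrightarrow> target \<sigma> (opponent p) (u(a := x, b := y)) = b)"

lemma contest_if_targets_differ:
  assumes "inj \<sigma>" "w \<noteq> terminal" "target \<sigma> p w = a" "target \<sigma> (opponent p) w = b" "a \<noteq> b"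
  shows "contest \<sigma> p a b (w(a := 0, b := 0))"
proof -
  let ?w = "\<lambda>x y. w(a := 0, b := 0, a := x, b := y)"
  have pos: "w a > 0" "w b > 0" using target_pos assms by auto
  then have support: "w j > 0" if "?w x y j > 0" for x y j
    using that by (auto split: if_splits)
  have "target \<sigma> p (?w x y) = a" if "x > 0" for x y
    using target_stable[of \<sigma> "?w x y" p w] support assms(1,3,5) that by simp
  moreover have "target \<sigma> (opponent p) (?w x y) = b" if "y > 0" for x y
    using target_stable[of \<sigma> "?w x y" "opponent p" w] support assms(1,4) that by simp
  ultimately show ?thesis using assms(5) by (simp add: contest_def)
qed

lemma contest_wins_first:
  assumes "contest \<sigma> p a b u" "x' < x" "wins_second \<sigma> p (u(a := x', b := y))"
  shows "wins_first \<sigma> p (u(a := x, b := y))"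
proof (rule wins_first_by_reducing[of _ a _ _ x'])
  have "u(a := x, b := y, a := x') = u(a := x', b := y)"
    using assms(1) by (auto simp: contest_def fun_eq_iff)
  then show "wins_second \<sigma> p (u(a := x, b := y, a := x'))" using assms by simp
qed (use assms in \<open>auto simp: contest_def\<close>)

lemma contest_wins_second:
  assumes "contest \<sigma> p a b u" "y > 0"
    and "\<And>y'. y' < y \<Longrightarrow> wins_first \<sigma> p (u(a := x, b := y'))"
  shows "wins_second \<sigma> p (u(a := x, b := y))"
  by (rule wins_second_by_answering[of _ _ _ b]) (use assms in \<open>auto simp: contest_def\<close>)

lemma contest_cleared:
  assumes "contest \<sigma> p a b u"
  shows "u(a := 0, b := 0) = u"
  using assms by (auto simp: contest_def fun_eq_iff)

text \<open>Player \<open>p\<close> answers each reduction of \<open>b\<close> by the same reduction of \<open>a\<close>. The heights agree whenever the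
opponent is to move, so \<open>p\<close> makes the last clearing and the opponent has to start \<open>u\<close>.\<close>

lemma mirror:
  assumes "contest \<sigma> p a b u" "wins_second \<sigma> p u"
  shows "wins_second \<sigma> p (u(a := k, b := k))"
proof (induction k rule: less_induct)
  case (less k)
  show ?case
  proof (cases "k = 0")
    case True
    then show ?thesis using assms contest_cleared by metis
  next
    case False
    show ?thesis
    proof (rule contest_wins_second[OF assms(1)])
      show "wins_first \<sigma> p (u(a := k, b := y))" if "y < k" for y
        using contest_wins_first[OF assms(1) that] less.IH[OF that] .
    qed (use False in simp)
  qed
qed

lemma mirror_start:
  assumes "contest \<sigma> p a b u" "wins_second \<sigma> p u" "y < x"
  shows "wins_first \<sigma> p (u(a := x, b := y))"
  using contest_wins_first[OF assms(1,3)] mirror[OF assms(1,2)] .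

text \<open>Player \<open>p\<close> removes one token. If the opponent also removes just one, the piles are equal again
and lower; if the opponent removes more, \<open>p\<close> catches up and mirrors from then on. If both piles come
down to one token, \<open>p\<close> clears, the opponent has to clear as well, and \<open>p\<close> starts \<open>u\<close>. Depending on the
opponent \<open>p\<close> enters \<open>u\<close> in either role, which is why both wins on \<open>u\<close> are assumed.\<close>

lemma step_down:
  assumes "contest \<sigma> p a b u" "wins_second \<sigma> p u" "wins_first \<sigma> p u"
  shows "wins_first \<sigma> p (u(a := k, b := k))"
proof (induction k)
  case 0
  then show ?case using assms contest_cleared by metis
next
  case (Suc k)
  have "wins_second \<sigma> p (u(a := k, b := Suc k))"
  proof (rule contest_wins_second[OF assms(1)])
    fix y assume "y < Suc k"
    then consider "y = k" | "y < k" by linarith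
    then show "wins_first \<sigma> p (u(a := k, b := y))"
    proof cases
      case 1
      then show ?thesis using Suc by metis
    next
      case 2
      then show ?thesis using mirror_start[OF assms(1,2)] by blast
    qed
  qed simp
  then show ?case by (rule contest_wins_first[OF assms(1) lessI])
qed

text \<open>Here \<open>p\<close> wants to start \<open>u\<close>, so the opponent must be made to clear last. Since the opponent's
target after clearing \<open>b\<close> is \<open>a\<close>, the opponent cannot escape into \<open>u\<close>. Player \<open>p\<close> mirrors except at the
end: when the opponent clears \<open>b\<close>, one token is left in \<open>a\<close> for the opponent to take, and when the
opponent reduces \<open>b\<close> to one token, \<open>p\<close> clears \<open>a\<close>. Leaving one token takes a pile of at least two.\<close>

lemma keep_spare_token:
  assumes contest: "contest \<sigma> p a b u" and "wins_first \<sigma> p u"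
    and blocked: "\<And>x. x > 0 \<Longrightarrow> target \<sigma> (opponent p) (u(a := x)) = a"
    and "k \<ge> 2"
  shows "wins_second \<sigma> p (u(a := k, b := k))"
proof -
  have ab: "u(a := x, b := 0) = u(a := x)" "u(a := 0) = u" for x
    using contest by (auto simp: contest_def fun_eq_iff)
  \<comment> \<open>The opponent has cleared \<open>b\<close>: leave one token in \<open>a\<close>.\<close>
  have zero: "wins_first \<sigma> p (u(a := x, b := 0))" if "x \<ge> 2" for x
  proof -
    have "wins_second \<sigma> p (u(a := 1))"
      by (rule wins_second_by_answering[of _ _ _ a]) (use blocked ab assms(2) in auto)
    then show ?thesis
      using contest_wins_first[OF contest, of 1 x 0] that ab by simp
  qed
  \<comment> \<open>The opponent has left one token in \<open>b\<close>: clear \<open>a\<close>.\<close>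
  have one: "wins_first \<sigma> p (u(a := x, b := 1))" if "x \<ge> 2" for x
  proof -
    have "wins_second \<sigma> p (u(a := 0, b := 1))"
      by (rule contest_wins_second[OF contest])
        (use contest_cleared[OF contest] assms(2) in auto)
    then show ?thesis
      using contest_wins_first[OF contest, of 0 x 1] that by simp
  qed
  show ?thesis
    using \<open>k \<ge> 2\<close>
  proof (induction k rule: less_induct)
    case (less k)
    have "wins_first \<sigma> p (u(a := k, b := y))" if "y < k" for y
    proof -
      consider "y = 0" | "y = 1" | "y \<ge> 2" by linarith
      then show ?thesis
      proof cases
        case 3
        show ?thesis using contest_wins_first[OF contest that] less.IH[OF that 3] .
      qed (use zero one less.prems in simp_all)
    qed
    moreover have "k > 0" using less.prems by simp
    ultimately show ?case using contest_wins_second[OF contest, of k k] by blast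
  qed
qed

section \<open>Equal piles in uniform positions\<close>

lemma uniformD:
  assumes "w \<in> uniform n m"
  shows "w \<in> positions n" and "w i > 0 \<Longrightarrow> w i = m" and "w(i := 0) \<in> uniform n m"
proof -
  show w: "w \<in> positions n" using assms by (simp add: uniform_def)
  show "w i = m" if "w i > 0"
  proof -
    have "i \<in> {1..n}" using w that by (force simp: positions_def)
    then show ?thesis using assms that by (force simp: uniform_def)
  qed
  show "w(i := 0) \<in> uniform n m" using assms by (simp add: uniform_def positions_def)
qed

lemma opponent_confined_wins_second:
  assumes "inj \<sigma>" "w \<in> uniform n m" "w \<noteq> terminal" "m \<ge> 2"
    and a: "target \<sigma> p w = a" and b: "target \<sigma> (opponent p) w = b" and "a \<noteq> b"
    and blocked: "target \<sigma> (opponent p) (w(b := 0)) = a"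
    and first: "wins_first \<sigma> p (w(a := 0, b := 0))"
  shows "wins_second \<sigma> p w"
proof -
  let ?u = "w(a := 0, b := 0)"
  have pos: "w a > 0" "w b > 0" using target_pos[OF assms(3)] a b by blast+
  have contest: "contest \<sigma> p a b ?u"
    by (rule contest_if_targets_differ[OF assms(1,3) a b \<open>a \<noteq> b\<close>])
  have "target \<sigma> (opponent p) (?u(a := x)) = a" if "x > 0" for x
  proof -
    have "?u(a := x) = w(b := 0, a := x)" using \<open>a \<noteq> b\<close> by (auto simp: fun_eq_iff)
    moreover have "target \<sigma> (opponent p) (w(b := 0, a := x)) = a"
    proof (rule trans[OF target_stable[OF assms(1)] blocked])
      show "(w(b := 0, a := x)) (target \<sigma> (opponent p) (w(b := 0))) > 0"
        unfolding blocked using that by simp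
      show "(w(b := 0)) j > 0" if "(w(b := 0, a := x)) j > 0" for j
        using that pos \<open>a \<noteq> b\<close> by (cases "j = a") auto
    qed
    ultimately show ?thesis by simp
  qed
  then have "wins_second \<sigma> p (?u(a := m, b := m))"
    using keep_spare_token[OF contest first _ assms(4)] by blast
  moreover have "?u(a := m, b := m) = w"
    using uniformD(2)[OF assms(2)] pos \<open>a \<noteq> b\<close> by (auto simp: fun_eq_iff)
  ultimately show ?thesis by simp
qed

lemma distinct_targets_mirror:
  assumes "inj \<sigma>" "w \<in> uniform n m" "w \<noteq> terminal"
    and a: "target \<sigma> p w = a" and b: "target \<sigma> (opponent p) w = b" and "a \<noteq> b"
    and second: "wins_second \<sigma> p (w(a := 0, b := 0))"
  shows "wins_second \<sigma> p w"
    and "wins_first \<sigma> p (w(a := 0, b := 0)) \<Longrightarrow> wins_first \<sigma> p w"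
proof -
  let ?u = "w(a := 0, b := 0)"
  have pos: "w a > 0" "w b > 0" using target_pos[OF assms(3)] a b by blast+
  have contest: "contest \<sigma> p a b ?u"
    by (rule contest_if_targets_differ[OF assms(1,3) a b \<open>a \<noteq> b\<close>])
  have w: "?u(a := m, b := m) = w"
    using uniformD(2)[OF assms(2)] pos \<open>a \<noteq> b\<close> by (auto simp: fun_eq_iff)
  show "wins_second \<sigma> p w" using mirror[OF contest second, of m] w by simp
  show "wins_first \<sigma> p w" if "wins_first \<sigma> p ?u"
    using step_down[OF contest second that, of m] w by simp
qed

section \<open>The first player wins by clearing\<close>

text \<open>What \<open>p\<close> needs behind the own target of \<open>u\<close> in order to win when the opponent has to dispose of an
additional pile first: the first alternative enables \<open>mirror\<close>, the second \<open>keep_spare_token\<close>.\<close>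

definition advance :: "(nat \<Rightarrow> nat) \<Rightarrow> player \<Rightarrow> position \<Rightarrow> bool" where
  "advance \<sigma> p u \<longleftrightarrow> wins_second \<sigma> p (clear \<sigma> p u) \<or>
     wins_first \<sigma> p (clear \<sigma> p u) \<and> target \<sigma> (opponent p) u = target \<sigma> p u"

text \<open>Behind the opponent's pile \<open>b\<close> the target of \<open>p\<close> is the same as in \<open>v\<close>. So the two target piles of \<open>v\<close>
form a contest whose rest is \<open>v(b := 0)\<close> with the target of \<open>p\<close> cleared, the very position that
\<open>advance\<close> speaks of.\<close>

lemma wins_second_before_advance:
  assumes "inj \<sigma>" "v \<in> uniform n m" "v \<noteq> terminal" "m \<ge> 2"
    and b: "target \<sigma> (opponent p) v = b" "target \<sigma> p v \<noteq> b"
    and adv: "advance \<sigma> p (v(b := 0))"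
  shows "wins_second \<sigma> p v"
proof -
  obtain c where cv: "target \<sigma> p v = c" by blast
  have ne: "c \<noteq> b" using b cv by blast
  have pos: "v c > 0" using target_pos[OF assms(3)] cv by blast
  have c: "target \<sigma> p (v(b := 0)) = c"
    using target_stable[OF assms(1), of "v(b := 0)" p v] pos ne
    by (auto simp: cv split: if_splits)
  have t: "clear \<sigma> p (v(b := 0)) = v(c := 0, b := 0)"
    using ne by (auto simp: clear_def c fun_eq_iff)
  show ?thesis
  proof (cases "wins_second \<sigma> p (v(c := 0, b := 0))")
    case True
    then show ?thesis by (rule distinct_targets_mirror(1)[OF assms(1-3) cv b(1) ne])
  next
    case False
    then have "wins_first \<sigma> p (v(c := 0, b := 0))" "target \<sigma> (opponent p) (v(b := 0)) = c"
      using adv by (auto simp: advance_def t c)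
    then show ?thesis
      using opponent_confined_wins_second[OF assms(1-4) cv b(1) ne] by blast
  qed
qed

text \<open>With a common target, the opponent would win moving second if the opponent won the rest in both
roles; hence \<open>p\<close> wins the rest in some role. With distinct targets, let \<open>s\<close> be \<open>u\<close> without both
targets. A player winning \<open>s\<close> as second would win \<open>u\<close> as second, so \<open>s\<close> too is won by the first player,
and by induction it satisfies \<open>advance\<close>. The position left when \<open>p\<close> clears consists of the opponent's
pile in front of \<open>s\<close> and has distinct targets, since otherwise \<open>p\<close>, confined to the two piles, could
not win \<open>u\<close> moving first. So \<open>wins_second_before_advance\<close> applies to it.\<close>

lemma advance_if_outcome_N:
  assumes "inj \<sigma>" "m \<ge> 2" "u \<in> uniform n m" "wins_first \<sigma> p u" "wins_first \<sigma> (opponent p) u"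
  shows "advance \<sigma> p u"
  using assms(3-5)
proof (induction "\<Sum>i\<in>{1..n}. u i" arbitrary: u rule: less_induct)
  case less
  note det = wins_second_iff_not_wins_first
  obtain a b where a: "target \<sigma> p u = a" and b: "target \<sigma> (opponent p) u = b" by blast
  have nt: "u \<noteq> terminal" using wins_first_not_terminal less.prems(2) .
  have pos: "u a > 0" "u b > 0" using target_pos[OF nt] a b by blast+
  have uu: "u(a := 0) \<in> uniform n m" "u(a := 0, b := 0) \<in> uniform n m"
    using uniformD(3) less.prems(1) by blast+
  note un = uniformD(1)[OF less.prems(1)] uniformD(1)[OF uu(1)] uniformD(1)[OF uu(2)]
  have not_second: "\<not> wins_second \<sigma> (opponent p) u" "\<not> wins_second \<sigma> p u"
    using det[OF un(1)] less.prems by auto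
  have clear: "clear \<sigma> p u = u(a := 0)" by (simp add: clear_def a)
  show ?case
  proof (cases "a = b")
    case True
    have targets: "target \<sigma> q (u(a := k)) = a" if "k > 0" for q k
      using common_targets[OF assms(1) nt a _ that] b True by blast
    have "wins_second \<sigma> (opponent p) (u(a := u a))"
      if "wins_first \<sigma> (opponent p) (u(a := 0))" "wins_second \<sigma> (opponent p) (u(a := 0))"
      using common_pile_wins_second[OF targets that pos(1)] by blast
    then have "\<not> (wins_first \<sigma> (opponent p) (u(a := 0)) \<and>
        wins_second \<sigma> (opponent p) (u(a := 0)))"
      using not_second by auto
    then show ?thesis
      using det[OF un(2), of \<sigma> p] det[OF un(2), of \<sigma> "opponent p"] True
      unfolding advance_def clear a b by auto
  next
    case False
    let ?s = "u(a := 0, b := 0)"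
    have s': "u(b := 0, a := 0) = ?s" using False by (auto simp: fun_eq_iff)
    have b': "target \<sigma> (opponent (opponent p)) u = a" using a by simp
    have "\<not> wins_second \<sigma> p ?s"
      using distinct_targets_mirror(1)[OF assms(1) less.prems(1) nt a b False] not_second by blast
    moreover have "\<not> wins_second \<sigma> (opponent p) ?s"
      using distinct_targets_mirror(1)[OF assms(1) less.prems(1) nt b b'] False s' not_second
      by metis
    ultimately have fs: "wins_first \<sigma> p ?s" "wins_first \<sigma> (opponent p) ?s"
      using det[OF un(3), of \<sigma> p] det[OF un(3), of \<sigma> "opponent p"] by auto
    let ?t = "u(a := 0)"
    have tb: "?t b > 0" using pos False by auto
    then have tnt: "?t \<noteq> terminal" by (metis less_irrefl terminal_def)
    have bt: "target \<sigma> (opponent p) ?t = b"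
      using target_stable[OF assms(1), of ?t "opponent p" u] tb b by (auto split: if_splits)
    have "target \<sigma> p ?t \<noteq> b"
    proof
      assume "target \<sigma> p ?t = b"
      then have "wins_second \<sigma> (opponent p) u"
        using opponent_confined_wins_second[OF assms(1) less.prems(1) nt assms(2) b b'] False fs s'
        by (metis opponent_opponent)
      then show False using not_second by blast
    qed
    moreover have "advance \<sigma> p ?s"
    proof (rule less.hyps)
      have "move \<sigma> p u ?t" "move \<sigma> (opponent p) ?t ?s"
        using move_clear[OF nt a] move_clear[OF tnt bt] by blast+
      then show "(\<Sum>i\<in>{1..n}. ?s i) < (\<Sum>i\<in>{1..n}. u i)"
        using move_positions(2)[OF un(1)] move_positions(2)[OF un(2)] by (meson less_trans)
    qed (use uu fs in blast)+
    ultimately have "wins_second \<sigma> p ?t"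
      using wins_second_before_advance[OF assms(1) uu(1) tnt assms(2) bt] by blast
    then show ?thesis by (simp add: advance_def clear)
  qed
qed

text \<open>After the clearing move \<open>p\<close> has a target beyond \<open>b\<close>, so the opponent, who is to move, has the pile \<open>b\<close>
in front of a position that satisfies \<open>advance\<close>.\<close>

lemma free_clearing_wins_first:
  assumes "inj \<sigma>" "w \<in> uniform n m" "w \<noteq> terminal" "m \<ge> 2"
    and a: "target \<sigma> p w = a" and b: "target \<sigma> (opponent p) w = b" and "a \<noteq> b"
    and free: "target \<sigma> p (w(a := 0)) \<noteq> b"
    and first: "wins_first \<sigma> p (w(a := 0, b := 0))"
      "wins_first \<sigma> (opponent p) (w(a := 0, b := 0))"
  shows "wins_first \<sigma> p w"
proof -
  let ?v = "w(a := 0)"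
  have pos: "w a > 0" "w b > 0" using target_pos[OF assms(3)] a b by blast+
  have vb: "?v b > 0" using pos \<open>a \<noteq> b\<close> by auto
  then have vnt: "?v \<noteq> terminal" by (metis less_irrefl terminal_def)
  have bv: "target \<sigma> (opponent p) ?v = b"
    using target_stable[OF assms(1), of ?v "opponent p" w] vb b by (auto split: if_splits)
  have v: "?v \<in> uniform n m" using uniformD(3) assms(2) by blast
  have "advance \<sigma> p (?v(b := 0))"
    using advance_if_outcome_N[OF assms(1,4) uniformD(3)[OF v] first] .
  then have "wins_second \<sigma> p ?v" by (rule wins_second_before_advance[OF assms(1) v vnt assms(4) bv free])
  then show ?thesis using wins_first_by_reducing[of w a \<sigma> p 0] pos a by simp
qed

section \<open>The recursion for uniform positions\<close>

theorem theorem4p2: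
  fixes n m :: nat and \<sigma> :: "nat \<Rightarrow> nat" and w :: position
  assumes "n \<ge> 1"
    and "\<sigma> permutes {1..n}"
    and "m \<ge> 2"
    and "w \<in> uniform_plus n m"
  defines "wL \<equiv> clear \<sigma> Left w"
    and "wR \<equiv> clear \<sigma> Right w"
    and "wLR \<equiv> clear \<sigma> Right (clear \<sigma> Left w)"
  shows
    "(w \<in> uniform_eq n \<sigma> m \<longrightarrow>
        outcome \<sigma> w = replace_outcome \<P> \<N> (outcome \<sigma> (clear_common \<sigma> w))) \<and>
     (w \<in> uniform_neq n \<sigma> m \<and> wL \<in> uniform_eq n \<sigma> m \<and> wR \<in> uniform_eq n \<sigma> m \<longrightarrow>
        outcome \<sigma> w = replace_outcome \<N> \<P> (outcome \<sigma> wLR)) \<and>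
     (w \<in> uniform_neq n \<sigma> m \<and> wL \<in> uniform_neq n \<sigma> m \<and> wR \<in> uniform_eq n \<sigma> m \<longrightarrow>
        outcome \<sigma> w = replace_outcome \<N> \<L> (outcome \<sigma> wLR)) \<and>
     (w \<in> uniform_neq n \<sigma> m \<and> wL \<in> uniform_eq n \<sigma> m \<and> wR \<in> uniform_neq n \<sigma> m \<longrightarrow>
        outcome \<sigma> w = replace_outcome \<N> \<R> (outcome \<sigma> wLR)) \<and>
     (w \<in> uniform_neq n \<sigma> m \<and> wL \<in> uniform_neq n \<sigma> m \<and> wR \<in> uniform_neq n \<sigma> m \<longrightarrow>
        outcome \<sigma> w = outcome \<sigma> wLR)"
proof -
  have inj: "inj \<sigma>" using assms(2) permutes_inj by blast
  have un: "w \<in> uniform n m" and nt: "w \<noteq> terminal"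
    using assms(4) by (auto simp: uniform_plus_def positions_plus_def)
  have wn: "w \<in> positions n" by (rule uniformD(1)[OF un])
  obtain a b where a: "target \<sigma> Left w = a" and b: "target \<sigma> Right w = b" by blast
  have pos: "w a > 0" "w b > 0" using target_pos[OF nt] a b by blast+
  have wL: "wL = w(a := 0)" and wR: "wR = w(b := 0)"
    by (simp_all add: wL_def wR_def clear_def a b)
  have common: "outcome \<sigma> w = replace_outcome \<P> \<N> (outcome \<sigma> (clear_common \<sigma> w))"
    if "a = b"
  proof -
    have t: "clear_common \<sigma> w = w(a := 0)"
      by (simp add: clear_common_def clear_def a)
    have tn: "w(a := 0) \<in> positions n" by (rule uniformD(1)[OF uniformD(3)[OF un]])
    have wa: "w(a := w a) = w" "w a \<ge> 2" using uniformD(2)[OF un] pos \<open>m \<ge> 2\<close> by auto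
    have targets: "target \<sigma> q (w(a := k)) = a" if "k > 0" for q k
      using common_targets[OF inj nt a _ that] b \<open>a = b\<close> by simp
    have first: "wins_first \<sigma> q w"
      if "wins_first \<sigma> q (w(a := 0)) \<or> wins_second \<sigma> q (w(a := 0))" for q
      using common_pile_wins_first[OF targets that wa(2)] wa(1) by simp
    have second: "wins_second \<sigma> q w"
      if "wins_first \<sigma> q (w(a := 0))" "wins_second \<sigma> q (w(a := 0))" for q
      using common_pile_wins_second[OF targets that pos(1)] wa(1) by simp
    show ?thesis
      using first second outcome_iff[OF tn, THEN iffD1]
      by (cases "outcome \<sigma> (w(a := 0))")
        (simp_all add: t replace_outcome_def outcome_iff[OF wn])
  qed
  have distinct: ?thesis if ne: "a \<noteq> b"
  proof -
    let ?u = "w(a := 0, b := 0)"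
    have u': "?u = w(b := 0, a := 0)" using ne by (auto simp: fun_eq_iff)
    have vb: "wL b > 0" and va: "wR a > 0" using pos ne by (auto simp: wL wR)
    have bL: "target \<sigma> Right wL = b"
      using target_stable[OF inj, of wL Right w] vb
      by (auto simp: wL b split: if_splits)
    have aR: "target \<sigma> Left wR = a"
      using target_stable[OF inj, of wR Left w] va
      by (auto simp: wR a split: if_splits)
    have LR: "wLR = ?u"
      unfolding wLR_def wL_def[symmetric] using bL by (simp only: clear_def wL)
    have uu: "?u \<in> positions n" by (rule uniformD(1)[OF uniformD(3)[OF uniformD(3)[OF un]]])
    note ab = a b[folded opponent.simps(1)] ne
    note ba = b a[folded opponent.simps(2)] ne[symmetric]
    have second: "wins_second \<sigma> q w" if "wins_second \<sigma> q ?u" for q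
      using distinct_targets_mirror(1)[OF inj un nt ab] distinct_targets_mirror(1)[OF inj un nt ba]
        that u' by (cases q) auto
    have first: "wins_first \<sigma> q w" if "wins_second \<sigma> q ?u" "wins_first \<sigma> q ?u" for q
      using distinct_targets_mirror(2)[OF inj un nt ab] distinct_targets_mirror(2)[OF inj un nt ba]
        that u' by (cases q) auto
    \<comment> \<open>These four facts settle the case that \<open>?u\<close> has outcome \<open>\<N>\<close>; the two above settle the others.\<close>
    have L2: "wins_second \<sigma> Left w" if "target \<sigma> Right wR = a" "wins_first \<sigma> Left ?u"
      using opponent_confined_wins_second[OF inj un nt assms(3) ab] that by (simp add: wR)
    have R2: "wins_second \<sigma> Right w" if "target \<sigma> Left wL = b" "wins_first \<sigma> Right ?u"
      using opponent_confined_wins_second[OF inj un nt assms(3) ba] that by (simp add: wL u')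
    have L1: "wins_first \<sigma> Left w"
      if "target \<sigma> Left wL \<noteq> b" "wins_first \<sigma> Left ?u" "wins_first \<sigma> Right ?u"
      using free_clearing_wins_first[OF inj un nt assms(3) ab] that by (simp add: wL)
    have R1: "wins_first \<sigma> Right w"
      if "target \<sigma> Right wR \<noteq> a" "wins_first \<sigma> Left ?u" "wins_first \<sigma> Right ?u"
      using free_clearing_wins_first[OF inj un nt assms(3) ba] that by (simp add: wR u')
    have eqs: "w \<notin> uniform_eq n \<sigma> m"
      "wL \<in> uniform_eq n \<sigma> m \<Longrightarrow> target \<sigma> Left wL = b"
      "wL \<in> uniform_neq n \<sigma> m \<Longrightarrow> target \<sigma> Left wL \<noteq> b"
      "wR \<in> uniform_eq n \<sigma> m \<Longrightarrow> target \<sigma> Right wR = a"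
      "wR \<in> uniform_neq n \<sigma> m \<Longrightarrow> target \<sigma> Right wR \<noteq> a"
      by (simp_all add: uniform_eq_def uniform_neq_def positions_eq_def positions_neq_def
          a b ne aR bL)
    show ?thesis
      using first second L1 L2 R1 R2 eqs outcome_iff[OF uu, THEN iffD1] unfolding LR
      by (cases "outcome \<sigma> ?u")
        (simp_all add: replace_outcome_def outcome_iff[OF wn])
  qed
  show ?thesis
  proof (cases "a = b")
    case True
    then have "w \<notin> uniform_neq n \<sigma> m"
      by (simp add: uniform_neq_def positions_neq_def a b)
    then show ?thesis using common[OF True] by blast
  qed (rule distinct)
qed

end
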